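(* Let $\mathcal{A} \subseteq M_n$ be a block upper-triangular subalgebra and let $\phi : \mathcal{A} \to M_n$ be a Jordan embedding. Then there exists an invertible matrix $T \in M_n$ such that either $\phi(X) = TXT^{-1}$ for all $X \in \mathcal{A}$, or $\phi(X) = TX^{t}T^{-1}$ for all $X \in \mathcal{A}$.
   Context: $n$ is a positive integer, $M_n$ is the algebra of $n\times n$ complex matrices, $M_{p,q}$ is the space of $p\times q$ complex matrices, and $X^t$ is the transpose of $X$. A block upper-triangular subalgebra of $M_n$ is a subalgebra of $M_n$ containing all upper-triangular matrices; equivalently, it is one of the algebras $\mathcal{A}_{k_1,\ldots,k_r}$, where $r,k_1,\ldots,k_r\in\mathbb{N}$ (positive integers) satisfy $k_1+\cdots+k_r=n$ and $\mathcal{A}_{k_1,\ldots,k_r}$ consists of all matrices in $M_n$ partitioned into blocks $(X_{ij})_{1\le i,j\le r}$ with $X_{ij}\in M_{k_i,k_j}$ and $X_{ij}=0$ for $i>j$ (the case $r=1$ gives $M_n$ itself). A Jordan homomorphism between complex algebras is a linear map $\phi$ such that $\phi(a\circ b)=\phi(a)\circ\phi(b)$ for all $a,b$, where $x\circ y=xy+yx$ (equivalently $\phi(a^2)=\phi(a)^2$ for all $a$). A Jordan embedding is an injective Jordan homomorphism. *)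

theory Defs
  imports Complex_Main "Jordan_Normal_Form.Matrix" "HOL-Library.FuncSet"
begin

definition mat_subalgebra :: "nat \<Rightarrow> complex mat set \<Rightarrow> bool" where
  "mat_subalgebra n A \<longleftrightarrow>
     A \<subseteq> carrier_mat n n \<and> 0\<^sub>m n n \<in> A \<and>
     (\<forall>X\<in>A. \<forall>Y\<in>A. X + Y \<in> A) \<and>
     (\<forall>c. \<forall>X\<in>A. c \<cdot>\<^sub>m X \<in> A) \<and>
     (\<forall>X\<in>A. \<forall>Y\<in>A. X * Y \<in> A)"

(* These are exactly the algebras of block upper-triangular matrices for some
   ordered partition k_1 + ... + k_r = n of n into positive block sizes. *)
definition block_upper_triangular_subalgebra :: "nat \<Rightarrow> complex mat set \<Rightarrow> bool" where
  "block_upper_triangular_subalgebra n A \<longleftrightarrow>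
     mat_subalgebra n A \<and> {X \<in> carrier_mat n n. upper_triangular X} \<subseteq> A"

definition jordan_product :: "complex mat \<Rightarrow> complex mat \<Rightarrow> complex mat" where
  "jordan_product X Y = X * Y + Y * X"

(* A and B are meant to be matrix algebras; phi is only constrained on A. *)
definition jordan_hom ::
    "complex mat set \<Rightarrow> complex mat set \<Rightarrow> (complex mat \<Rightarrow> complex mat) \<Rightarrow> bool" where
  "jordan_hom A B \<phi> \<longleftrightarrow>
     \<phi> \<in> A \<rightarrow> B \<and>
     (\<forall>X\<in>A. \<forall>Y\<in>A. \<phi> (X + Y) = \<phi> X + \<phi> Y) \<and>
     (\<forall>c. \<forall>X\<in>A. \<phi> (c \<cdot>\<^sub>m X) = c \<cdot>\<^sub>m \<phi> X) \<and>
     (\<forall>X\<in>A. \<forall>Y\<in>A. \<phi> (jordan_product X Y) = jordan_product (\<phi> X) (\<phi> Y))"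

definition jordan_embedding ::
    "complex mat set \<Rightarrow> complex mat set \<Rightarrow> (complex mat \<Rightarrow> complex mat) \<Rightarrow> bool" where
  "jordan_embedding A B \<phi> \<longleftrightarrow> jordan_hom A B \<phi> \<and> inj_on \<phi> A"

end

theory Submission
  imports Defs "Jordan_Normal_Form.Determinant"
begin

text \<open>
  The images of the diagonal matrix units are nonzero orthogonal idempotents, so after a conjugation
  they are the diagonal matrix units themselves. The Peirce components are Jordan expressions, hence
  for \<open>i \<noteq> j\<close> the matrix unit \<open>E\<^sub>i\<^sub>j\<close> is mapped to \<open>a E\<^sub>i\<^sub>j + b E\<^sub>j\<^sub>i\<close>, where exactly one of
  \<open>a\<close>, \<open>b\<close> is nonzero because \<open>E\<^sub>i\<^sub>j\<close> squares to zero. Comparing with the first row, which always lies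
  in the algebra, shows that the same alternative occurs for all \<open>i \<noteq> j\<close>; up to transposition
  \<open>b = 0\<close>, and then \<open>a\<close> is a coboundary, which a diagonal conjugation removes.
\<close>

section \<open>Matrix units and their products\<close>

definition unit_mat :: "nat \<Rightarrow> nat \<Rightarrow> nat \<Rightarrow> complex mat" where
  "unit_mat n i j = mat n n (\<lambda>(k, l). if k = i \<and> l = j then 1 else 0)"

lemma unit_mat_carrier [simp]: "unit_mat n i j \<in> carrier_mat n n"
  by (simp add: unit_mat_def)

lemma unit_mat_dim [simp]: "dim_row (unit_mat n i j) = n" "dim_col (unit_mat n i j) = n"
  by (simp_all add: unit_mat_def)

lemma unit_mat_index [simp]:
  "k < n \<Longrightarrow> l < n \<Longrightarrow> unit_mat n i j $$ (k, l) = (if k = i \<and> l = j then 1 else 0)"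
  by (simp add: unit_mat_def)

lemma unit_mat_mult_left:
  assumes "X \<in> carrier_mat n n" "j < n" "k < n" "l < n"
  shows "(unit_mat n i j * X) $$ (k, l) = (if k = i then X $$ (j, l) else 0)"
proof -
  have "(unit_mat n i j * X) $$ (k, l) = (\<Sum>m<n. (if m = j then (if k = i then X $$ (j, l) else 0) else 0))"
    using assms by (auto simp: scalar_prod_def atLeast0LessThan if_distrib[of "\<lambda>x. x * _"] cong: if_cong)
  then show ?thesis
    using assms by simp
qed

lemma unit_mat_mult_right:
  assumes "X \<in> carrier_mat n n" "i < n" "k < n" "l < n"
  shows "(X * unit_mat n i j) $$ (k, l) = (if l = j then X $$ (k, i) else 0)"
proof -
  have "(X * unit_mat n i j) $$ (k, l) = (\<Sum>m<n. (if m = i then (if l = j then X $$ (k, i) else 0) else 0))"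
    using assms by (auto simp: scalar_prod_def atLeast0LessThan if_distrib[of "(*) _"] cong: if_cong)
  then show ?thesis
    using assms by simp
qed

lemma jordan_product_carrier [simp]:
  "X \<in> carrier_mat n n \<Longrightarrow> Y \<in> carrier_mat n n \<Longrightarrow> jordan_product X Y \<in> carrier_mat n n"
  by (simp add: jordan_product_def)

lemma jordan_product_unit_mat:
  assumes "X \<in> carrier_mat n n" "i < n" "j < n" "k < n" "l < n"
  shows "jordan_product X (unit_mat n i j) $$ (k, l) =
    (if l = j then X $$ (k, i) else 0) + (if k = i then X $$ (j, l) else 0)"
  \<comment> \<open>\<open>index_mult_mat(1)\<close> is removed from the simp set here and below: it
    would expand entries of products into scalar products before the rules for matrix units can
    match.\<close>
  using assms by (simp add: jordan_product_def unit_mat_mult_left unit_mat_mult_right del: index_mult_mat(1))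

section \<open>Simultaneous diagonalization of orthogonal idempotents\<close>

text \<open>Multiplying \<open>P * Q + Q * P = 0\<close> by \<open>P\<close> on the left and on the
  right gives \<open>P * Q = - P * Q * P = Q * P\<close>, so the vanishing sum is
  \<open>2 * P * Q\<close>. This turns the Jordan form of orthogonality into the associative
  one.\<close>

lemma orthogonal_idempotents:
  fixes P Q :: "complex mat"
  assumes P: "P \<in> carrier_mat n n" "P * P = P"
    and Q: "Q \<in> carrier_mat n n"
    and PQ: "jordan_product P Q = 0\<^sub>m n n"
  shows "P * Q = 0\<^sub>m n n"
proof -
  have sum: "P * Q + Q * P = 0\<^sub>m n n"
    using PQ by (simp add: jordan_product_def)
  have "P * (P * Q + Q * P) = P * P * Q + P * Q * P"
    using P(1) Q by (simp add: mult_add_distrib_mat[of _ n n _ n] assoc_mult_mat[of _ n n _ n _ n])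
  then have left: "P * Q + P * Q * P = 0\<^sub>m n n"
    using P Q sum by simp
  have "(P * Q + Q * P) * P = P * Q * P + Q * (P * P)"
    using P(1) Q by (simp add: add_mult_distrib_mat[of _ n n] assoc_mult_mat[of _ n n _ n _ n])
  then have right: "P * Q * P + Q * P = 0\<^sub>m n n"
    using P Q sum by simp
  show ?thesis
  proof (rule eq_matI)
    fix k l assume "k < dim_row (0\<^sub>m n n :: complex mat)" "l < dim_col (0\<^sub>m n n :: complex mat)"
    then have kl: "k < n" "l < n"
      by auto
    have entry: "M $$ (k, l) + N $$ (k, l) = 0"
      if "M + N = 0\<^sub>m n n" "N \<in> carrier_mat n n" for M N :: "complex mat"
      using arg_cong[OF that(1), of "\<lambda>M. M $$ (k, l)"] that(2) kl by simp
    have "(P * Q) $$ (k, l) + (Q * P) $$ (k, l) = 0"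
      "(P * Q) $$ (k, l) + (P * Q * P) $$ (k, l) = 0"
      "(P * Q * P) $$ (k, l) + (Q * P) $$ (k, l) = 0"
      by (intro entry sum left right; use P Q in simp)+
    moreover have "x = 0" if "x + y = 0" "x + z = 0" "z + y = 0" for x y z :: complex
    proof -
      have "2 * x = (x + y) + (x + z) - (z + y)"
        by simp
      then show ?thesis
        using that by simp
    qed
    ultimately have "(P * Q) $$ (k, l) = 0"
      by blast
    then show "(P * Q) $$ (k, l) = 0\<^sub>m n n $$ (k, l)"
      using kl by (simp del: index_mult_mat(1))
  qed (use P Q in auto)
qed

text \<open>The equation \<open>P * P = P\<close> says that \<open>P\<close> fixes each of its
  columns, so any nonzero column serves.\<close>

lemma idempotent_fixed_vector:
  fixes P :: "complex mat"
  assumes P: "P \<in> carrier_mat n n" "P * P = P" "P \<noteq> 0\<^sub>m n n"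
  shows "\<exists>v\<in>carrier_vec n. v \<noteq> 0\<^sub>v n \<and> P *\<^sub>v v = v"
proof -
  obtain k l where kl: "k < n" "l < n" "P $$ (k, l) \<noteq> 0"
    using P by (metis carrier_matD eq_matI index_zero_mat)
  have "col P l $ k \<noteq> 0\<^sub>v n $ k"
    using P kl by simp
  then have "col P l \<noteq> 0\<^sub>v n"
    by auto
  moreover have "P *\<^sub>v col P l = col P l"
    using col_mult2[of P n n P n l] P kl by simp
  ultimately show ?thesis
    using P kl by (intro bexI[of _ "col P l"]) auto
qed

text \<open>There are as many idempotents as dimensions, so choosing one fixed vector of each gives
  a basis. In this basis, the columns of \<open>T\<close>, every \<open>P i\<close> acts as a
  diagonal matrix unit.\<close>

lemma orthogonal_idempotents_diagonalizable:
  fixes P :: "nat \<Rightarrow> complex mat"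
  assumes P: "\<And>i. i < n \<Longrightarrow> P i \<in> carrier_mat n n"
    and idem: "\<And>i. i < n \<Longrightarrow> P i * P i = P i"
    and orth: "\<And>i j. i < n \<Longrightarrow> j < n \<Longrightarrow> i \<noteq> j \<Longrightarrow> P i * P j = 0\<^sub>m n n"
    and nonzero: "\<And>i. i < n \<Longrightarrow> P i \<noteq> 0\<^sub>m n n"
  shows "\<exists>T\<in>carrier_mat n n. \<exists>T'\<in>carrier_mat n n. T * T' = 1\<^sub>m n \<and> T' * T = 1\<^sub>m n \<and>
    (\<forall>i<n. T' * P i * T = unit_mat n i i)"
proof -
  have "\<forall>i<n. \<exists>v\<in>carrier_vec n. v \<noteq> 0\<^sub>v n \<and> P i *\<^sub>v v = v"
    using idempotent_fixed_vector P idem nonzero by blast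
  then obtain v where v: "\<And>i. i < n \<Longrightarrow> v i \<in> carrier_vec n" "\<And>i. i < n \<Longrightarrow> v i \<noteq> 0\<^sub>v n"
    "\<And>i. i < n \<Longrightarrow> P i *\<^sub>v v i = v i"
    by metis
  define T where "T = mat n n (\<lambda>(k, i). v i $ k)"
  have T: "T \<in> carrier_mat n n"
    by (simp add: T_def)
  have col_T: "col T i = v i" if "i < n" for i
    using that v(1)[OF that] by (intro eq_vecI) (auto simp: T_def)
  have Pv: "P i *\<^sub>v v j = (if i = j then v i else 0\<^sub>v n)" if "i < n" "j < n" for i j
  proof (cases "i = j")
    case False
    have "P i *\<^sub>v v j = P i *\<^sub>v (P j *\<^sub>v v j)"
      using v that by simp
    also have "\<dots> = (P i * P j) *\<^sub>v v j"
      using P v that by (metis assoc_mult_mat_vec)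
    also have "\<dots> = 0\<^sub>m n n *\<^sub>v v j"
      using False that by (simp add: orth)
    also have "\<dots> = 0\<^sub>v n"
      using v(1)[OF that(2)] by (intro eq_vecI) auto
    finally show ?thesis
      using False by simp
  qed (use v that in simp)
  have PT: "P i * T = T * unit_mat n i i" if i: "i < n" for i
  proof (rule eq_matI)
    fix k l assume "k < dim_row (T * unit_mat n i i)" "l < dim_col (T * unit_mat n i i)"
    then have kl: "k < n" "l < n"
      using T by auto
    have "(P i * T) $$ (k, l) = (P i *\<^sub>v v l) $ k"
      using P[OF i] T kl col_T by simp
    also have "\<dots> = (T * unit_mat n i i) $$ (k, l)"
      using T i kl by (auto simp: Pv unit_mat_mult_right T_def simp del: index_mult_mat(1))
    finally show "(P i * T) $$ (k, l) = (T * unit_mat n i i) $$ (k, l)" .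
  qed (use P[OF i] T in auto)
  \<comment> \<open>The columns are independent: if \<open>T\<close> kills \<open>x\<close>, then
    \<open>P i\<close> applied to \<open>T x\<close> is zero, but by \<open>PT\<close> it is also
    \<open>x $ i\<close> times the nonzero vector \<open>v i\<close>.\<close>
  have "det T \<noteq> 0"
  proof
    assume "det T = 0"
    then obtain x where x: "x \<in> carrier_vec n" "x \<noteq> 0\<^sub>v n" "T *\<^sub>v x = 0\<^sub>v n"
      using det_0_iff_vec_prod_zero_field[OF T] by blast
    have "x $ i = 0" if i: "i < n" for i
    proof -
      obtain k where k: "k < n" "v i $ k \<noteq> 0"
        using v(1,2)[OF i] by (metis carrier_vecD eq_vecI index_zero_vec)
      have "(T * unit_mat n i i) *\<^sub>v x = P i *\<^sub>v (T *\<^sub>v x)"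
        using PT[OF i] P[OF i] T x by (metis assoc_mult_mat_vec)
      then have "((T * unit_mat n i i) *\<^sub>v x) $ k = 0"
        using x P[OF i] k by simp
      moreover have "((T * unit_mat n i i) *\<^sub>v x) $ k = (\<Sum>l<n. (T * unit_mat n i i) $$ (k, l) * x $ l)"
        using x T k by (simp add: scalar_prod_def atLeast0LessThan del: index_mult_mat(1))
      moreover have "\<dots> = (\<Sum>l<n. if l = i then v i $ k * x $ i else 0)"
        using T i k by (intro sum.cong) (auto simp: unit_mat_mult_right T_def simp del: index_mult_mat(1))
      ultimately show ?thesis
        using i k by simp
    qed
    then show False
      using x by auto
  qed
  \<comment> \<open>The argument \<open>()\<close> only fills the extension slot of the record
    \<open>ring_mat\<close>.\<close>
  from det_non_zero_imp_unit[OF T this, of "()"]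
  obtain T' where T': "T' \<in> carrier_mat n n" "T * T' = 1\<^sub>m n" "T' * T = 1\<^sub>m n"
    by (auto simp: Units_def ring_mat_def)
  have "T' * P i * T = unit_mat n i i" if i: "i < n" for i
  proof -
    have "T' * P i * T = T' * (T * unit_mat n i i)"
      using T T' P[OF i] PT[OF i] by (simp add: assoc_mult_mat[of _ n n _ n _ n])
    also have "\<dots> = unit_mat n i i"
      using T T' by (simp add: assoc_mult_mat[of _ n n _ n _ n, symmetric])
    finally show ?thesis .
  qed
  then show ?thesis
    using T T' by blast
qed

section \<open>Peirce components as Jordan expressions\<close>

text \<open>
  Both Peirce identities express entries of \<open>X\<close> by iterated Jordan products, so that a Jordan
  homomorphism can be compared entry by entry, without decomposing \<open>X\<close> into matrix units.
\<close>

lemma peirce_diagonal: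
  assumes "X \<in> carrier_mat n n" "i < n"
  shows "jordan_product (jordan_product X (unit_mat n i i)) (unit_mat n i i) =
    jordan_product X (unit_mat n i i) + (2 * X $$ (i, i)) \<cdot>\<^sub>m unit_mat n i i"
  using assms carrier_matD[OF jordan_product_carrier[OF assms(1) unit_mat_carrier]]
    carrier_matD[OF jordan_product_carrier[OF jordan_product_carrier[OF assms(1) unit_mat_carrier] unit_mat_carrier]]
  by (intro eq_matI) (auto simp: jordan_product_unit_mat)

lemma peirce_off_diagonal:
  assumes "X \<in> carrier_mat n n" "i < n" "j < n" "i \<noteq> j"
  shows "jordan_product (jordan_product X (unit_mat n i i)) (unit_mat n j j) =
    X $$ (i, j) \<cdot>\<^sub>m unit_mat n i j + X $$ (j, i) \<cdot>\<^sub>m unit_mat n j i"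
  using assms
    carrier_matD[OF jordan_product_carrier[OF jordan_product_carrier[OF assms(1) unit_mat_carrier] unit_mat_carrier]]
  by (intro eq_matI) (auto simp: jordan_product_unit_mat)

text \<open>Bilinearity for the combinations that will occur as images of off-diagonal matrix
  units.\<close>

lemma jordan_product_combination:
  assumes "X \<in> carrier_mat n n" "i < n" "j < n" "k < n" "l < n"
  shows "jordan_product X (a \<cdot>\<^sub>m unit_mat n i j + b \<cdot>\<^sub>m unit_mat n j i) $$ (k, l) =
    a * jordan_product X (unit_mat n i j) $$ (k, l) + b * jordan_product X (unit_mat n j i) $$ (k, l)"
  using assms
  by (simp add: jordan_product_def mult_add_distrib_mat[of _ n n _ n] add_mult_distrib_mat[of _ n n]
      mult_smult_distrib[of _ n n _ n] mult_smult_assoc_mat[of _ n n] ring_distribs del: index_mult_mat(1))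

section \<open>Jordan embeddings and the images of diagonal matrix units\<close>

text \<open>A locale allows the same facts to be instantiated again for conjugates and transposes of
  \<phi>.\<close>

locale block_upper_jordan =
  fixes n :: nat and A :: "complex mat set" and \<phi> :: "complex mat \<Rightarrow> complex mat"
  assumes block_upper: "block_upper_triangular_subalgebra n A"
    and embedding: "jordan_embedding A (carrier_mat n n) \<phi>"
begin

lemma carrier: "X \<in> A \<Longrightarrow> X \<in> carrier_mat n n"
  using block_upper
  by (auto simp: block_upper_triangular_subalgebra_def mat_subalgebra_def)

lemma closed:
  shows add_closed: "X \<in> A \<Longrightarrow> Y \<in> A \<Longrightarrow> X + Y \<in> A"
    and smult_closed: "X \<in> A \<Longrightarrow> c \<cdot>\<^sub>m X \<in> A"
    and mult_closed: "X \<in> A \<Longrightarrow> Y \<in> A \<Longrightarrow> X * Y \<in> A"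
    and jordan_closed: "X \<in> A \<Longrightarrow> Y \<in> A \<Longrightarrow> jordan_product X Y \<in> A"
    and zero_closed: "0\<^sub>m n n \<in> A"
  using block_upper
  by (auto simp: block_upper_triangular_subalgebra_def mat_subalgebra_def jordan_product_def)

lemma unit_mat_mem: "i \<le> j \<Longrightarrow> unit_mat n i j \<in> A"
proof -
  assume "i \<le> j"
  then have "upper_triangular (unit_mat n i j)"
    by (intro upper_triangularI) auto
  then show ?thesis
    using block_upper by (auto simp: block_upper_triangular_subalgebra_def)
qed

text \<open>Cutting \<open>X\<close> down by the diagonal matrix units, which lie in
  \<open>A\<close>, leaves a nonzero multiple of \<open>unit_mat n i j\<close>. This replaces any
  explicit description of \<open>A\<close> by block sizes.\<close>

lemma unit_mat_mem_of_entry: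
  assumes "X \<in> A" "i < n" "j < n" "X $$ (i, j) \<noteq> 0"
  shows "unit_mat n i j \<in> A"
proof -
  have X: "X \<in> carrier_mat n n"
    using assms carrier by blast
  have "unit_mat n i j = (1 / X $$ (i, j)) \<cdot>\<^sub>m (unit_mat n i i * (X * unit_mat n j j))" (is "_ = ?R")
  proof (rule eq_matI)
    fix k l assume kl: "k < dim_row ?R" "l < dim_col ?R"
    then have "(unit_mat n i i * (X * unit_mat n j j)) $$ (k, l) = (if k = i \<and> l = j then X $$ (i, j) else 0)"
      using X assms by (simp add: unit_mat_mult_left unit_mat_mult_right del: index_mult_mat(1))
    then show "unit_mat n i j $$ (k, l) = ?R $$ (k, l)"
      using kl X assms by (simp del: index_mult_mat(1))
  qed (use X in auto)
  then show ?thesis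
    using assms unit_mat_mem closed by simp
qed

lemma phi_carrier [simp]: "X \<in> A \<Longrightarrow> \<phi> X \<in> carrier_mat n n"
  and phi_add: "X \<in> A \<Longrightarrow> Y \<in> A \<Longrightarrow> \<phi> (X + Y) = \<phi> X + \<phi> Y"
  and phi_smult: "X \<in> A \<Longrightarrow> \<phi> (c \<cdot>\<^sub>m X) = c \<cdot>\<^sub>m \<phi> X"
  and phi_jordan: "X \<in> A \<Longrightarrow> Y \<in> A \<Longrightarrow> \<phi> (jordan_product X Y) = jordan_product (\<phi> X) (\<phi> Y)"
  and phi_inj: "X \<in> A \<Longrightarrow> Y \<in> A \<Longrightarrow> \<phi> X = \<phi> Y \<Longrightarrow> X = Y"
  using embedding by (auto simp: jordan_embedding_def jordan_hom_def dest: inj_onD)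

lemma phi_zero: "\<phi> (0\<^sub>m n n) = 0\<^sub>m n n"
proof -
  have "0\<^sub>m n n = (0::complex) \<cdot>\<^sub>m 0\<^sub>m n n"
    by auto
  then have "\<phi> (0\<^sub>m n n) = 0 \<cdot>\<^sub>m \<phi> (0\<^sub>m n n)"
    using phi_smult[OF zero_closed, of 0] by simp
  also have "\<dots> = 0\<^sub>m n n"
    using phi_carrier[OF zero_closed] by (intro eq_matI) auto
  finally show ?thesis .
qed

lemma phi_unit_mat_nonzero:
  assumes "i < n" "j < n" "unit_mat n i j \<in> A"
  shows "\<phi> (unit_mat n i j) \<noteq> 0\<^sub>m n n"
proof
  assume "\<phi> (unit_mat n i j) = 0\<^sub>m n n"
  then have "unit_mat n i j = 0\<^sub>m n n"
    using phi_inj[OF assms(3) zero_closed] phi_zero by simp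
  then have "unit_mat n i j $$ (i, j) = 0\<^sub>m n n $$ (i, j)"
    by simp
  then show False
    using assms by simp
qed

text \<open>The Jordan square of an idempotent is twice that idempotent, and the factor 2 can be
  cancelled entrywise.\<close>

lemma phi_diag_idempotent:
  assumes "i < n"
  shows "\<phi> (unit_mat n i i) * \<phi> (unit_mat n i i) = \<phi> (unit_mat n i i)"
proof -
  let ?E = "unit_mat n i i"
  have E: "?E \<in> A"
    by (simp add: unit_mat_mem)
  have "jordan_product ?E ?E = 2 \<cdot>\<^sub>m ?E"
    using assms carrier_matD[OF jordan_product_carrier[OF unit_mat_carrier unit_mat_carrier]]
    by (intro eq_matI) (auto simp: jordan_product_unit_mat)
  then have double: "\<phi> ?E * \<phi> ?E + \<phi> ?E * \<phi> ?E = 2 \<cdot>\<^sub>m \<phi> ?E"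
    using phi_jordan[OF E E] phi_smult[OF E] by (simp add: jordan_product_def)
  have P: "\<phi> ?E \<in> carrier_mat n n"
    using E by simp
  show ?thesis
  proof (rule eq_matI)
    fix k l assume kl: "k < dim_row (\<phi> ?E)" "l < dim_col (\<phi> ?E)"
    have "(\<phi> ?E * \<phi> ?E + \<phi> ?E * \<phi> ?E) $$ (k, l) = (2 \<cdot>\<^sub>m \<phi> ?E) $$ (k, l)"
      by (simp only: double)
    then show "(\<phi> ?E * \<phi> ?E) $$ (k, l) = \<phi> ?E $$ (k, l)"
      using P kl by (simp del: index_mult_mat(1))
  qed (use P in auto)
qed

lemma phi_diag_orthogonal:
  assumes "i < n" "j < n" "i \<noteq> j"
  shows "\<phi> (unit_mat n i i) * \<phi> (unit_mat n j j) = 0\<^sub>m n n"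
proof (rule orthogonal_idempotents)
  have "jordan_product (unit_mat n i i) (unit_mat n j j) = 0\<^sub>m n n"
    using assms carrier_matD[OF jordan_product_carrier[OF unit_mat_carrier unit_mat_carrier]]
    by (intro eq_matI) (auto simp: jordan_product_unit_mat)
  then show "jordan_product (\<phi> (unit_mat n i i)) (\<phi> (unit_mat n j j)) = 0\<^sub>m n n"
    using phi_jordan[of "unit_mat n i i" "unit_mat n j j"] phi_zero by (simp add: unit_mat_mem)
qed (use assms phi_diag_idempotent unit_mat_mem in auto)

section \<open>Conjugation and transposition of embeddings\<close>

text \<open>Since \<open>T * T' = 1\<close>, the inner factors cancel in a product of conjugates
  (\<open>mult\<close>), and \<phi> can be recovered from its conjugate (\<open>cancel\<close>),
  which preserves injectivity.\<close>

lemma conjugate: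
  assumes T: "T \<in> carrier_mat n n" "T' \<in> carrier_mat n n" "T * T' = 1\<^sub>m n"
  shows "block_upper_jordan n A (\<lambda>X. T' * \<phi> X * T)"
proof
  note assoc = assoc_mult_mat[of _ n n _ n _ n]
  have cancel: "T * (T' * Y * T) * T' = Y" if "Y \<in> carrier_mat n n" for Y
  proof -
    have "T * (T' * Y * T) * T' = (T * T') * Y * (T * T')"
      using that T(1,2) by (simp add: assoc)
    then show ?thesis
      using that T by simp
  qed
  have mult: "(T' * Y * T) * (T' * Z * T) = T' * (Y * Z) * T"
    if "Y \<in> carrier_mat n n" "Z \<in> carrier_mat n n" for Y Z
  proof -
    have "(T' * Y * T) * (T' * Z * T) = T' * Y * (T * T') * (Z * T)"
      using that T(1,2) by (simp add: assoc)
    then show ?thesis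
      using that T by (simp add: assoc)
  qed
  have add: "T' * (Y + Z) * T = T' * Y * T + T' * Z * T"
    if "Y \<in> carrier_mat n n" "Z \<in> carrier_mat n n" for Y Z
    using that T(1,2)
    by (simp add: mult_add_distrib_mat[of _ n n _ n] add_mult_distrib_mat[of _ n n])
  have smult: "T' * (c \<cdot>\<^sub>m Y) * T = c \<cdot>\<^sub>m (T' * Y * T)" if "Y \<in> carrier_mat n n" for c Y
    using that T(1,2)
    by (simp add: mult_smult_distrib[of _ n n _ n] mult_smult_assoc_mat[of _ n n])
  have "T' * \<phi> (jordan_product X Y) * T = jordan_product (T' * \<phi> X * T) (T' * \<phi> Y * T)"
    if "X \<in> A" "Y \<in> A" for X Y
    unfolding phi_jordan[OF that] unfolding jordan_product_def
    using phi_carrier[OF that(1)] phi_carrier[OF that(2)]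
    by (simp only: mult add mult_carrier_mat)
  moreover have "inj_on (\<lambda>X. T' * \<phi> X * T) A"
    using cancel phi_inj phi_carrier by (intro inj_onI) metis
  ultimately show "jordan_embedding A (carrier_mat n n) (\<lambda>X. T' * \<phi> X * T)"
    using T(1,2) by (auto simp: jordan_embedding_def jordan_hom_def phi_add add phi_smult smult)
qed (rule block_upper)

text \<open>Transposition reverses products, but the Jordan product is symmetric in its
  factors.\<close>

lemma transpose:
  "block_upper_jordan n A (\<lambda>X. transpose_mat (\<phi> X))"
proof
  have "transpose_mat (\<phi> (jordan_product X Y)) =
      jordan_product (transpose_mat (\<phi> X)) (transpose_mat (\<phi> Y))" if "X \<in> A" "Y \<in> A" for X Y
    unfolding phi_jordan[OF that] unfolding jordan_product_def
    using phi_carrier[OF that(1)] phi_carrier[OF that(2)]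
    by (simp add: transpose_add[of _ n n] transpose_mult[of _ n n _ n] comm_add_mat[of _ n n])
  moreover have "transpose_mat (c \<cdot>\<^sub>m M) = c \<cdot>\<^sub>m transpose_mat M" for c :: complex and M
    by (intro eq_matI) auto
  moreover have "inj_on (\<lambda>X. transpose_mat (\<phi> X)) A"
    by (intro inj_onI) (auto dest: phi_inj)
  ultimately show "jordan_embedding A (carrier_mat n n) (\<lambda>X. transpose_mat (\<phi> X))"
    by (auto simp: jordan_embedding_def jordan_hom_def phi_add phi_smult transpose_add[of _ n n])
qed (rule block_upper)

end

section \<open>Embeddings that fix the diagonal matrix units\<close>

locale diagonal_block_upper_jordan = block_upper_jordan +
  assumes phi_diag: "i < n \<Longrightarrow> \<phi> (unit_mat n i i) = unit_mat n i i"
begin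

text \<open>These two definitions are the numbers \<open>a\<close> and \<open>b\<close> in the image
  \<open>a E_ij + b E_ji\<close> of \<open>E_ij\<close>, as \<open>phi_unit_mat\<close> confirms.
  They carry information only if \<open>unit_mat n i j\<close> lies in \<open>A\<close>, since
  \<phi> is arbitrary elsewhere.\<close>

definition direct_coeff :: "nat \<Rightarrow> nat \<Rightarrow> complex" where
  "direct_coeff i j = \<phi> (unit_mat n i j) $$ (i, j)"

definition flipped_coeff :: "nat \<Rightarrow> nat \<Rightarrow> complex" where
  "flipped_coeff i j = \<phi> (unit_mat n i j) $$ (j, i)"

text \<open>The Peirce identity for \<open>\<phi> X\<close> is compared with the image of the one
  for \<open>X\<close>; the common summand \<open>jordan_product (\<phi> X) ?E\<close>
  cancels.\<close>

lemma phi_diag_entry: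
  assumes X: "X \<in> A" and i: "i < n"
  shows "\<phi> X $$ (i, i) = X $$ (i, i)"
proof -
  let ?E = "unit_mat n i i"
  have E: "?E \<in> A"
    by (simp add: unit_mat_mem)
  have "jordan_product (\<phi> X) ?E + (2 * \<phi> X $$ (i, i)) \<cdot>\<^sub>m ?E = \<phi> (jordan_product (jordan_product X ?E) ?E)"
    using X E i by (simp add: phi_jordan phi_diag jordan_closed peirce_diagonal)
  also have "\<dots> = jordan_product (\<phi> X) ?E + (2 * X $$ (i, i)) \<cdot>\<^sub>m ?E"
    using X E i carrier
    by (simp add: peirce_diagonal phi_add phi_smult phi_jordan phi_diag jordan_closed smult_closed)
  finally have "(jordan_product (\<phi> X) ?E + (2 * \<phi> X $$ (i, i)) \<cdot>\<^sub>m ?E) $$ (i, i) =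
      (jordan_product (\<phi> X) ?E + (2 * X $$ (i, i)) \<cdot>\<^sub>m ?E) $$ (i, i)"
    by simp
  then show ?thesis
    using i X by simp
qed

text \<open>As \<phi> fixes both diagonal units, it commutes with the iterated Jordan product that
  extracts the \<open>(i, j)\<close> and \<open>(j, i)\<close> components. These come out together,
  hence the sum.\<close>

lemma phi_off_diag:
  assumes X: "X \<in> A" and ij: "i < n" "j < n" "i \<noteq> j"
  shows "\<phi> (X $$ (i, j) \<cdot>\<^sub>m unit_mat n i j + X $$ (j, i) \<cdot>\<^sub>m unit_mat n j i) =
    \<phi> X $$ (i, j) \<cdot>\<^sub>m unit_mat n i j + \<phi> X $$ (j, i) \<cdot>\<^sub>m unit_mat n j i"
proof -
  have E: "unit_mat n i i \<in> A" "unit_mat n j j \<in> A"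
    by (simp_all add: unit_mat_mem)
  have "\<phi> (jordan_product (jordan_product X (unit_mat n i i)) (unit_mat n j j)) =
      jordan_product (jordan_product (\<phi> X) (unit_mat n i i)) (unit_mat n j j)"
    using X E ij by (simp add: phi_jordan phi_diag jordan_closed)
  then show ?thesis
    using X ij carrier by (simp add: peirce_off_diagonal)
qed

lemma phi_unit_mat:
  assumes E: "unit_mat n i j \<in> A" and ij: "i < n" "j < n" "i \<noteq> j"
  shows "\<phi> (unit_mat n i j) = direct_coeff i j \<cdot>\<^sub>m unit_mat n i j + flipped_coeff i j \<cdot>\<^sub>m unit_mat n j i"
proof -
  have "unit_mat n i j $$ (i, j) \<cdot>\<^sub>m unit_mat n i j + unit_mat n i j $$ (j, i) \<cdot>\<^sub>m unit_mat n j i =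
      unit_mat n i j"
    using ij by (intro eq_matI) auto
  then show ?thesis
    using phi_off_diag[OF E ij] by (simp add: direct_coeff_def flipped_coeff_def)
qed

text \<open>Additivity splits \<open>phi_off_diag\<close> once both summands are known to lie in
  \<open>A\<close>. At position \<open>(i, j)\<close> one sees the direct part of
  \<open>E_ij\<close> and the flipped part of \<open>E_ji\<close>.\<close>

lemma phi_entry:
  assumes X: "X \<in> A" and ij: "i < n" "j < n" "i \<noteq> j"
  shows "\<phi> X $$ (i, j) = X $$ (i, j) * direct_coeff i j + X $$ (j, i) * flipped_coeff j i"
proof -
  have mem: "X $$ (k, l) \<cdot>\<^sub>m unit_mat n k l \<in> A" if "k < n" "l < n" for k l
  proof (cases "X $$ (k, l) = 0")
    case True
    then have "X $$ (k, l) \<cdot>\<^sub>m unit_mat n k l = 0\<^sub>m n n"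
      by (intro eq_matI) auto
    then show ?thesis
      using zero_closed by simp
  qed (use unit_mat_mem_of_entry X that smult_closed in blast)
  have entry: "\<phi> (X $$ (k, l) \<cdot>\<^sub>m unit_mat n k l) $$ (i, j) = X $$ (k, l) * \<phi> (unit_mat n k l) $$ (i, j)"
    if "k < n" "l < n" for k l
  proof (cases "X $$ (k, l) = 0")
    case True
    then have "X $$ (k, l) \<cdot>\<^sub>m unit_mat n k l = 0\<^sub>m n n"
      by (intro eq_matI) auto
    then show ?thesis
      using True ij phi_zero by simp
  next
    case False
    then have "unit_mat n k l \<in> A"
      using unit_mat_mem_of_entry X that by blast
    then show ?thesis
      using carrier_matD[OF phi_carrier] ij by (simp add: phi_smult)
  qed
  have "\<phi> X $$ (i, j) =
      (\<phi> X $$ (i, j) \<cdot>\<^sub>m unit_mat n i j + \<phi> X $$ (j, i) \<cdot>\<^sub>m unit_mat n j i) $$ (i, j)"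
    using ij by simp
  also have "\<dots> = (\<phi> (X $$ (i, j) \<cdot>\<^sub>m unit_mat n i j) + \<phi> (X $$ (j, i) \<cdot>\<^sub>m unit_mat n j i)) $$ (i, j)"
    using mem ij by (simp only: phi_off_diag[OF X ij, symmetric] phi_add)
  also have "\<dots> = X $$ (i, j) * direct_coeff i j + X $$ (j, i) * flipped_coeff j i"
    using phi_carrier[OF mem[OF ij(2,1)]] ij by (simp add: entry direct_coeff_def flipped_coeff_def)
  finally show ?thesis .
qed

lemma jordan_product_phi:
  assumes "unit_mat n i j \<in> A" "i < n" "j < n" "i \<noteq> j" "X \<in> carrier_mat n n" "k < n" "l < n"
  shows "jordan_product X (\<phi> (unit_mat n i j)) $$ (k, l) =
    direct_coeff i j * ((if l = j then X $$ (k, i) else 0) + (if k = i then X $$ (j, l) else 0)) +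
    flipped_coeff i j * ((if l = i then X $$ (k, j) else 0) + (if k = j then X $$ (i, l) else 0))"
  using assms by (simp add: phi_unit_mat jordan_product_combination jordan_product_unit_mat)

section \<open>Relations between the coefficients\<close>

text \<open>As \<open>E_ij\<close> squares to zero, so does its image in the Jordan sense, and the
  \<open>(i, i)\<close> entry of that Jordan square is \<open>2 a b\<close>. The second claim is
  injectivity.\<close>

lemma coeff_exclusive:
  assumes E: "unit_mat n i j \<in> A" and ij: "i < n" "j < n" "i \<noteq> j"
  shows "direct_coeff i j * flipped_coeff i j = 0" "direct_coeff i j \<noteq> 0 \<or> flipped_coeff i j \<noteq> 0"
proof -
  have "jordan_product (unit_mat n i j) (unit_mat n i j) = 0\<^sub>m n n"
    using ij carrier_matD[OF jordan_product_carrier[OF unit_mat_carrier unit_mat_carrier]]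
    by (intro eq_matI) (auto simp: jordan_product_unit_mat)
  then have "jordan_product (\<phi> (unit_mat n i j)) (\<phi> (unit_mat n i j)) $$ (i, i) = 0"
    using ij by (simp add: phi_zero flip: phi_jordan[OF E E])
  then show "direct_coeff i j * flipped_coeff i j = 0"
    using E ij by (simp add: jordan_product_phi) (simp add: direct_coeff_def flipped_coeff_def)
  show "direct_coeff i j \<noteq> 0 \<or> flipped_coeff i j \<noteq> 0"
  proof (rule ccontr)
    assume "\<not> ?thesis"
    then have "\<phi> (unit_mat n i j) = 0\<^sub>m n n"
      using phi_unit_mat[OF E ij] by (auto intro: eq_matI)
    then show False
      using phi_unit_mat_nonzero E ij by blast
  qed
qed

text \<open>For distinct indices the Jordan product of \<open>E_ij\<close> and \<open>E_jk\<close>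
  is \<open>E_ik\<close>. In the product of the images, direct parts multiply in this order, flipped
  parts in the reverse order, and all mixed products vanish.\<close>

lemma coeff_mult:
  assumes "unit_mat n i j \<in> A" "unit_mat n j k \<in> A" "i < n" "j < n" "k < n" "i \<noteq> j" "j \<noteq> k" "i \<noteq> k"
  shows "direct_coeff i k = direct_coeff i j * direct_coeff j k"
    "flipped_coeff i k = flipped_coeff i j * flipped_coeff j k"
proof -
  have "jordan_product (unit_mat n i j) (unit_mat n j k) = unit_mat n i k"
    using assms carrier_matD[OF jordan_product_carrier[OF unit_mat_carrier unit_mat_carrier]]
    by (intro eq_matI) (auto simp: jordan_product_unit_mat)
  then have eq: "\<phi> (unit_mat n i k) = jordan_product (\<phi> (unit_mat n i j)) (\<phi> (unit_mat n j k))"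
    using phi_jordan[OF assms(1,2)] by simp
  show "direct_coeff i k = direct_coeff i j * direct_coeff j k"
    unfolding direct_coeff_def[of i k] eq
    \<comment> \<open>Two passes are needed: in a single one \<open>phi_unit_mat\<close> would
      rewrite the right factor before \<open>jordan_product_phi\<close> could match it.\<close>
    using assms by (simp add: jordan_product_phi) (simp add: phi_unit_mat)
  show "flipped_coeff i k = flipped_coeff i j * flipped_coeff j k"
    unfolding flipped_coeff_def[of i k] eq
    using assms by (simp add: jordan_product_phi) (simp add: phi_unit_mat)
qed

text \<open>The Jordan product of \<open>E_ij\<close> and \<open>E_ji\<close> is
  \<open>E_ii + E_jj\<close>, which \<phi> fixes; the relation is the \<open>(i, i)\<close> entry of
  this equality.\<close>

lemma coeff_swap:
  assumes "unit_mat n i j \<in> A" "unit_mat n j i \<in> A" "i < n" "j < n" "i \<noteq> j"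
  shows "direct_coeff i j * direct_coeff j i + flipped_coeff i j * flipped_coeff j i = 1"
proof -
  have "jordan_product (unit_mat n i j) (unit_mat n j i) = unit_mat n i i + unit_mat n j j"
    using assms carrier_matD[OF jordan_product_carrier[OF unit_mat_carrier unit_mat_carrier]]
    by (intro eq_matI) (auto simp: jordan_product_unit_mat)
  then have "jordan_product (\<phi> (unit_mat n i j)) (\<phi> (unit_mat n j i)) = unit_mat n i i + unit_mat n j j"
    using phi_jordan[OF assms(1,2)] assms(3,4) by (simp add: phi_add unit_mat_mem phi_diag)
  then have "jordan_product (\<phi> (unit_mat n i j)) (\<phi> (unit_mat n j i)) $$ (i, i) = 1"
    using assms by simp
  then show ?thesis
    using assms by (simp add: jordan_product_phi) (simp add: phi_unit_mat algebra_simps)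
qed

text \<open>The first row of matrix units always lies in \<open>A\<close>. By
  \<open>coeff_mult\<close> through index 1, whichever coefficient vanishes at \<open>(0, 1)\<close>
  vanishes along the whole row.\<close>

lemma coeff_dichotomy:
  "(\<forall>j. 0 < j \<and> j < n \<longrightarrow> flipped_coeff 0 j = 0) \<or> (\<forall>j. 0 < j \<and> j < n \<longrightarrow> direct_coeff 0 j = 0)"
proof (cases "1 < n")
  case True
  have step: "direct_coeff 0 j = direct_coeff 0 1 * direct_coeff 1 j"
      "flipped_coeff 0 j = flipped_coeff 0 1 * flipped_coeff 1 j"
    if "1 < j" "j < n" for j
    using coeff_mult[of 0 1 j] that by (simp_all add: unit_mat_mem)
  have "direct_coeff 0 1 = 0 \<or> flipped_coeff 0 1 = 0"
    using coeff_exclusive(1)[of 0 1] True by (simp add: unit_mat_mem)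
  then show ?thesis
    using step by (metis One_nat_def Suc_lessI mult_zero_left)
qed auto

section \<open>Removing the coboundary by a diagonal conjugation\<close>

lemma diagonal_similarity:
  assumes n: "n \<ge> 1" and zero: "\<And>j. 0 < j \<Longrightarrow> j < n \<Longrightarrow> flipped_coeff 0 j = 0"
  shows "\<exists>D\<in>carrier_mat n n. \<exists>D'\<in>carrier_mat n n. D * D' = 1\<^sub>m n \<and> D' * D = 1\<^sub>m n \<and>
    (\<forall>X\<in>A. \<phi> X = D * X * D')"
proof -
  \<comment> \<open>The first row is the potential of the coboundary; at \<open>0\<close> the value
    is 1 because \<open>unit_mat n 0 0\<close> is fixed.\<close>
  define d where "d j = (if j = 0 then 1 else direct_coeff 0 j)" for j
  have d: "d j \<noteq> 0" if "j < n" for j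
    using coeff_exclusive(2)[of 0 j] zero[of j] that by (auto simp: d_def unit_mat_mem)
  have coeffs: "flipped_coeff i j = 0 \<and> direct_coeff i j = d j / d i"
    if E: "unit_mat n i j \<in> A" and ij: "i < n" "j < n" "i \<noteq> j" for i j
  proof -
    \<comment> \<open>The second case is an entry of the first column, inverse to its mirror image
      by \<open>coeff_swap\<close>; the third compares \<open>(0, j)\<close> with the path through
      \<open>i\<close>.\<close>
    consider "i = 0" | "j = 0" "i \<noteq> 0" | "i \<noteq> 0" "j \<noteq> 0"
      by blast
    then have "direct_coeff i j = d j / d i"
    proof cases
      case 1
      then show ?thesis
        using ij by (simp add: d_def)
    next
      case 2
      then show ?thesis
        using coeff_swap[of 0 i] zero[of i] E ij d[of i] by (simp add: unit_mat_mem d_def field_simps)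
    next
      case 3
      then show ?thesis
        using coeff_mult(1)[of 0 i j] E ij d[of i] by (simp add: unit_mat_mem d_def field_simps)
    qed
    then show ?thesis
      \<comment> \<open>The direct coefficient is a quotient of nonzero numbers, so exclusivity
        kills the flipped one.\<close>
      using coeff_exclusive(1)[OF E ij] d ij by simp
  qed
  define D where "D = mat_diag n (\<lambda>i. 1 / d i)"
  define D' where "D' = mat_diag n d"
  have D: "D \<in> carrier_mat n n" "D' \<in> carrier_mat n n"
    by (simp_all add: D_def D'_def)
  have "D * D' = 1\<^sub>m n" "D' * D = 1\<^sub>m n"
    unfolding D_def D'_def mat_diag_diag
    by (auto simp: mat_diag_def d intro!: eq_matI)
  moreover have "\<phi> X = D * X * D'" if X: "X \<in> A" for X
  proof (rule eq_matI)
    have X': "X \<in> carrier_mat n n"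
      using X carrier by blast
    have prod: "D * X * D' = mat n n (\<lambda>(i, j). 1 / d i * X $$ (i, j) * d j)"
      using X' unfolding D_def D'_def
      by (subst mat_diag_mult_left[of X n n], simp, subst mat_diag_mult_right[of _ n n])
        (auto intro: eq_matI)
    then show "dim_row (\<phi> X) = dim_row (D * X * D')" "dim_col (\<phi> X) = dim_col (D * X * D')"
      using phi_carrier[OF X] by simp_all
    fix i j assume "i < dim_row (D * X * D')" "j < dim_col (D * X * D')"
    then have ij: "i < n" "j < n"
      by (simp_all add: prod)
    show "\<phi> X $$ (i, j) = (D * X * D') $$ (i, j)"
    proof (cases "i = j")
      case True
      then show ?thesis
        using ij X d by (simp add: phi_diag_entry prod)
    next
      case False
      \<comment> \<open>\<open>coeffs\<close> requires the matrix unit to lie in \<open>A\<close>,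
        which holds where the entry is nonzero; elsewhere both sides vanish.\<close>
      have "X $$ (i, j) * direct_coeff i j = X $$ (i, j) * (d j / d i)"
        using coeffs[of i j] unit_mat_mem_of_entry[OF X ij] ij False by (cases "X $$ (i, j) = 0") auto
      moreover have "X $$ (j, i) * flipped_coeff j i = 0"
        using coeffs[of j i] unit_mat_mem_of_entry[OF X ij(2,1)] ij False by auto
      ultimately show ?thesis
        using phi_entry[OF X ij False] ij by (simp add: prod)
    qed
  qed
  ultimately show ?thesis
    using D by blast
qed

text \<open>Diagonal matrix units are symmetric, so the normalization survives
  transposition.\<close>

lemma transpose_diagonal:
  "diagonal_block_upper_jordan n A (\<lambda>X. transpose_mat (\<phi> X))"
proof -
  interpret t: block_upper_jordan n A "\<lambda>X. transpose_mat (\<phi> X)"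
    by (rule transpose)
  show ?thesis
    by unfold_locales (auto simp: phi_diag intro!: eq_matI)
qed

text \<open>Transposing \<phi> exchanges direct and flipped coefficients, which reduces the second
  alternative to the first. Transposing back swaps the roles of \<open>D\<close> and
  \<open>D'\<close>.\<close>

lemma similarity_or_transposed_similarity:
  assumes n: "n \<ge> 1"
  shows "\<exists>D\<in>carrier_mat n n. \<exists>D'\<in>carrier_mat n n. D * D' = 1\<^sub>m n \<and> D' * D = 1\<^sub>m n \<and>
    ((\<forall>X\<in>A. \<phi> X = D * X * D') \<or> (\<forall>X\<in>A. \<phi> X = D * transpose_mat X * D'))"
  using coeff_dichotomy
proof
  assume "\<forall>j. 0 < j \<and> j < n \<longrightarrow> flipped_coeff 0 j = 0"
  then show ?thesis
    using diagonal_similarity[OF n] by blast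
next
  assume zero: "\<forall>j. 0 < j \<and> j < n \<longrightarrow> direct_coeff 0 j = 0"
  interpret t: diagonal_block_upper_jordan n A "\<lambda>X. transpose_mat (\<phi> X)"
    by (rule transpose_diagonal)
  have "t.flipped_coeff 0 j = 0" if "0 < j" "j < n" for j
    using zero that phi_carrier[OF unit_mat_mem, of 0 j] by (simp add: t.flipped_coeff_def direct_coeff_def)
  from t.diagonal_similarity[OF n this] obtain D D' where D: "D \<in> carrier_mat n n" "D' \<in> carrier_mat n n"
    "D * D' = 1\<^sub>m n" "D' * D = 1\<^sub>m n" "\<And>X. X \<in> A \<Longrightarrow> transpose_mat (\<phi> X) = D * X * D'"
    by blast
  have "\<phi> X = transpose_mat D' * transpose_mat X * transpose_mat D" if "X \<in> A" for X
  proof -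
    have "\<phi> X = transpose_mat (D * X * D')"
      using D(5)[OF that] by (metis transpose_transpose)
    then show ?thesis
      using D(1,2) carrier[OF that]
      by (simp add: transpose_mult[of _ n n _ n] assoc_mult_mat[of _ n n _ n _ n])
  qed
  moreover have "transpose_mat D' * transpose_mat D = 1\<^sub>m n" "transpose_mat D * transpose_mat D' = 1\<^sub>m n"
    using D by (simp_all flip: transpose_mult[of _ n n _ n])
  ultimately show ?thesis
    using D(1,2) by (intro bexI[of _ "transpose_mat D'"] bexI[of _ "transpose_mat D"]) auto
qed

end

section \<open>Undoing the normalization\<close>

theorem theorem1p3:
  fixes n :: nat and A :: "complex mat set" and \<phi> :: "complex mat \<Rightarrow> complex mat"
  assumes "n \<ge> 1"
    and "block_upper_triangular_subalgebra n A"
    and "jordan_embedding A (carrier_mat n n) \<phi>"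
  shows "\<exists>T\<in>carrier_mat n n. \<exists>T'\<in>carrier_mat n n.
           inverts_mat T T' \<and> inverts_mat T' T \<and>
           ((\<forall>X\<in>A. \<phi> X = T * X * T') \<or> (\<forall>X\<in>A. \<phi> X = T * transpose_mat X * T'))"
proof -
  interpret block_upper_jordan n A \<phi>
    using assms by unfold_locales
  note assoc = assoc_mult_mat[of _ n n _ n _ n]
  obtain T T' where T: "T \<in> carrier_mat n n" "T' \<in> carrier_mat n n" "T * T' = 1\<^sub>m n" "T' * T = 1\<^sub>m n"
    "\<And>i. i < n \<Longrightarrow> T' * \<phi> (unit_mat n i i) * T = unit_mat n i i"
    using orthogonal_idempotents_diagonalizable[of n "\<lambda>i. \<phi> (unit_mat n i i)", OF _
        phi_diag_idempotent phi_diag_orthogonal phi_unit_mat_nonzero]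
    by (auto simp: unit_mat_mem)
  interpret c: block_upper_jordan n A "\<lambda>X. T' * \<phi> X * T"
    using T by (intro conjugate)
  interpret c: diagonal_block_upper_jordan n A "\<lambda>X. T' * \<phi> X * T"
    using T by unfold_locales
  obtain D D' where D: "D \<in> carrier_mat n n" "D' \<in> carrier_mat n n" "D * D' = 1\<^sub>m n" "D' * D = 1\<^sub>m n"
    and cases: "(\<forall>X\<in>A. T' * \<phi> X * T = D * X * D') \<or> (\<forall>X\<in>A. T' * \<phi> X * T = D * transpose_mat X * D')"
    using c.similarity_or_transposed_similarity[OF assms(1)] by blast
  \<comment> \<open>\<open>Y\<close> stands for \<open>X\<close> or for its transpose, so that both
    alternatives are undone at once.\<close>
  have unconjugate: "\<phi> X = (T * D) * Y * (D' * T')"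
    if "X \<in> A" "Y \<in> carrier_mat n n" "T' * \<phi> X * T = D * Y * D'" for X Y
  proof -
    have "\<phi> X = (T * T') * \<phi> X * (T * T')"
      using T(3) phi_carrier[OF that(1)]
      by (simp add: left_mult_one_mat[of _ n n] right_mult_one_mat[of _ n n])
    also have "\<dots> = T * (T' * \<phi> X * T) * T'"
      using T(1,2) phi_carrier[OF that(1)] by (simp add: assoc)
    finally show ?thesis
      using T(1,2) D(1,2) that(2) by (simp add: that(3) assoc)
  qed
  have "(T * D) * (D' * T') = T * (D * D') * T'" "(D' * T') * (T * D) = D' * (T' * T) * D"
    using T(1,2) D(1,2) by (simp_all add: assoc)
  then have "inverts_mat (T * D) (D' * T')" "inverts_mat (D' * T') (T * D)"
    using T D by (simp_all add: inverts_mat_def)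
  moreover have "(\<forall>X\<in>A. \<phi> X = (T * D) * X * (D' * T')) \<or>
      (\<forall>X\<in>A. \<phi> X = (T * D) * transpose_mat X * (D' * T'))"
    using cases unconjugate carrier by (metis transpose_carrier_mat)
  ultimately show ?thesis
    using T D by (intro bexI[of _ "T * D"] bexI[of _ "D' * T'"]) auto
qed

end
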